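(* Let $m\ge1$, $a(z)=\sum_{s=-m}^ma_sz^s$ with $a_s\in\mathbb C$, $a_s=0$ for $|s|>m$, and $D_n=\det(a_{j-i})_{i,j=1}^n$. Let $n>m$, $N=n+m$, and let $\widehat C_N=a(\Pi_N)$. Assume that $\widehat C_N$ is nonsingular. If $S=\{n+1,\dots,N\}$, then $$D_n=\det(\widehat C_N)\,\det\bigl(\widehat C_N^{-1}[S,S]\bigr).$$ Moreover $\widehat C_N^{-1}$ is circulant, and if $$g_r^{(N)}=\frac1N\sum_{\omega^N=1}\frac{\omega^{-r}}{a(\omega)},\qquad|r|\le m-1,$$ then $$D_n=\left(\prod_{\omega^N=1}a(\omega)\right)\det\bigl(g_{j-i}^{(N)}\bigr)_{i,j=1}^m.$$ Thus the correction determinant has order $m$, independent of $n$.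
   Context: $\Pi_N$ is the $N\times N$ cyclic shift matrix, with $(i,j)$ entry $1$ if $j\equiv i+1\pmod N$ and $0$ otherwise, so $a(\Pi_N)=\sum_{s=-m}^ma_s\Pi_N^s$ is a circulant matrix whose leading $n\times n$ block is $(a_{j-i})_{i,j=1}^n$. $M[S,S]$ denotes the submatrix of $M$ with rows and columns in $S$. Sums and products over $\omega^N=1$ run over all complex $N$-th roots of unity. *)

theory Defs
  imports
    Complex_Main
    "Jordan_Normal_Form.Determinant"
    "Jordan_Normal_Form.DL_Submatrix"
begin

text \<open>Matrices are indexed from 0, so the mathematical entry \<open>(i + 1, j + 1)\<close> is
  \<open>A $$ (i, j)\<close>. Conditions and entries depending only on \<open>j - i\<close> are unaffected by this shift.\<close>

abbreviation cmat_ring :: "nat \<Rightarrow> complex mat ring" where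
  "cmat_ring N \<equiv> ring_mat TYPE(complex) N ()"

definition toeplitz_mat :: "nat \<Rightarrow> (int \<Rightarrow> complex) \<Rightarrow> complex mat" where
  "toeplitz_mat n c = mat n n (\<lambda>(i, j). c (int j - int i))"

definition cyclic_shift :: "nat \<Rightarrow> complex mat" where
  "cyclic_shift N = mat N N (\<lambda>(i, j). if j mod N = (i + 1) mod N then 1 else 0)"

definition laurent_eval :: "nat \<Rightarrow> (int \<Rightarrow> complex) \<Rightarrow> complex \<Rightarrow> complex" where
  "laurent_eval m a z = (\<Sum>s = - int m..int m. a s * z powi s)"

text \<open>The power with integer exponent is the one of the matrix ring: for \<open>s < 0\<close> it is the
  ring inverse of the power with exponent \<open>- s\<close>, which makes sense for units such as
  \<open>cyclic_shift N\<close>.\<close>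

definition laurent_mat :: "nat \<Rightarrow> nat \<Rightarrow> (int \<Rightarrow> complex) \<Rightarrow> complex mat \<Rightarrow> complex mat" where
  "laurent_mat N m a P =
     (\<Oplus>\<^bsub>cmat_ring N\<^esub>s\<in>{- int m..int m}. a s \<cdot>\<^sub>m (P [^]\<^bsub>cmat_ring N\<^esub> s))"

definition circulant_mat :: "nat \<Rightarrow> complex mat \<Rightarrow> bool" where
  "circulant_mat N A \<longleftrightarrow> A \<in> carrier_mat N N \<and>
     (\<exists>c :: int \<Rightarrow> complex. \<forall>i<N. \<forall>j<N. A $$ (i, j) = c ((int j - int i) mod int N))"

definition inv_symbol_coeff :: "nat \<Rightarrow> nat \<Rightarrow> (int \<Rightarrow> complex) \<Rightarrow> int \<Rightarrow> complex" where
  "inv_symbol_coeff N m a r =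
     1 / of_nat N * (\<Sum>\<omega> | \<omega> ^ N = 1. \<omega> powi (- r) / laurent_eval m a \<omega>)"

end

theory Submission
  imports Defs
begin

text \<open>All matrices of the form \<open>F \<Lambda> F\<inverse>\<close> with \<open>F\<close> the discrete Fourier matrix are circulant, and
  they multiply and invert through their spectrum \<open>\<Lambda>\<close>. The cyclic shift has spectrum \<open>\<omega>\<close>, so
  \<open>a(\<Pi>)\<close> has spectrum \<open>a(\<omega>)\<close>; this yields its determinant and the entries of its inverse.
  Since \<open>N = n + m\<close>, no wrap-around reaches the leading \<open>n \<times> n\<close> block of \<open>a(\<Pi>)\<close>, which is
  therefore Toeplitz, and Jacobi's identity for complementary minors expresses its determinant
  by the trailing \<open>m \<times> m\<close> block of the inverse.\<close>

section \<open>Complementary minors\<close>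

text \<open>Replacing the first n columns of B by unit columns gives a matrix \<open>M\<close> whose
  determinant is that of the trailing block of B. Since A maps the last n + 1, ..., n + m columns of
  B to unit columns, \<open>A * M\<close> is block lower triangular with diagonal blocks
  \<open>A1\<close> and the identity. Multiplicativity of the determinant then gives Jacobi's
  identity without any division.\<close>

lemma det_leading_block:
  fixes A B :: "'a :: idom mat"
  assumes A: "A \<in> carrier_mat (n + m) (n + m)" and B: "B \<in> carrier_mat (n + m) (n + m)"
    and AB: "A * B = 1\<^sub>m (n + m)"
  shows "det (mat n n (\<lambda>(i, j). A $$ (i, j))) =
    det A * det (mat m m (\<lambda>(i, j). B $$ (n + i, n + j)))"
proof -
  obtain A1 A2 A3 A4 where sA: "split_block A n n = (A1, A2, A3, A4)"
    by (metis prod_cases4)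
  obtain B1 B2 B3 B4 where sB: "split_block B n n = (B1, B2, B3, B4)"
    by (metis prod_cases4)
  have dA: "dim_row A = n + m" "dim_col A = n + m" and dB: "dim_row B = n + m" "dim_col B = n + m"
    using A B by auto
  note bA = split_block[OF sA dA] and bB = split_block[OF sB dB]
  have A1: "A1 = mat n n (\<lambda>(i, j). A $$ (i, j))"
    using sA unfolding split_block_def Let_def by auto
  have B4: "B4 = mat m m (\<lambda>(i, j). B $$ (n + i, n + j))"
    using sB dB unfolding split_block_def Let_def by (auto simp: add.commute)
  have prod: "four_block_mat (A1 * B1 + A2 * B3) (A1 * B2 + A2 * B4)
      (A3 * B1 + A4 * B3) (A3 * B2 + A4 * B4) = 1\<^sub>m (n + m)"
    using AB bA(5) bB(5) mult_four_block_mat[OF bA(1-4) bB(1-4)] by simp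
  \<comment> \<open>\<open>e2\<close> and \<open>e4\<close> compare the right block columns of
    \<open>A * B\<close> and of the identity; they become the right block column of
    \<open>A * M\<close>.\<close>
  have e2: "A1 * B2 + A2 * B4 = 0\<^sub>m n m"
  proof (rule eq_matI)
    fix i j assume ij: "i < dim_row (0\<^sub>m n m :: 'a mat)" "j < dim_col (0\<^sub>m n m :: 'a mat)"
    have "(1\<^sub>m (n + m) :: 'a mat) $$ (i, n + j) = (A1 * B2 + A2 * B4) $$ (i, j)"
      unfolding prod[symmetric] using ij bA bB by (subst index_mat_four_block) auto
    thus "(A1 * B2 + A2 * B4) $$ (i, j) = 0\<^sub>m n m $$ (i, j)" using ij by simp
  qed (use bA bB in auto)
  have e4: "A3 * B2 + A4 * B4 = 1\<^sub>m m"
  proof (rule eq_matI)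
    fix i j assume ij: "i < dim_row (1\<^sub>m m :: 'a mat)" "j < dim_col (1\<^sub>m m :: 'a mat)"
    have "(1\<^sub>m (n + m) :: 'a mat) $$ (n + i, n + j) = (A3 * B2 + A4 * B4) $$ (i, j)"
      unfolding prod[symmetric] using ij bA bB by (subst index_mat_four_block) auto
    thus "(A3 * B2 + A4 * B4) $$ (i, j) = 1\<^sub>m m $$ (i, j)" using ij by simp
  qed (use bA bB in auto)
  define M where "M = four_block_mat (1\<^sub>m n) B2 (0\<^sub>m m n) B4"
  have M: "M \<in> carrier_mat (n + m) (n + m)"
    unfolding M_def using bB by auto
  have "A * M = four_block_mat A1 (0\<^sub>m n m) A3 (1\<^sub>m m)"
    unfolding M_def using bA bB e2 e4
    by (subst bA(5), subst mult_four_block_mat[of _ n n _ m _ m]) auto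
  hence "det A * det M = det A1"
    using det_mult[OF A M] det_four_block_mat_upper_right_zero[OF bA(1) refl bA(3), of "1\<^sub>m m"]
    by simp
  moreover have "det M = det B4"
    unfolding M_def
    using det_four_block_mat_lower_left_zero[OF _ bB(2) refl bB(4), of "1\<^sub>m n"] by simp
  ultimately show ?thesis using A1 B4 by simp
qed

lemma submatrix_atLeastLessThan:
  assumes "A \<in> carrier_mat (n + m) (n + m)"
  shows "submatrix A {n..<n + m} {n..<n + m} = mat m m (\<lambda>(i, j). A $$ (n + i, n + j))"
proof -
  have eq: "{i. i < n + m \<and> i \<in> {n..<n + m}} = {n..<n + m}" by auto
  \<comment> \<open>\<open>submatrix_index_card\<close> locates an entry by the number of selected
    indices below it; for index n + i this number is i.\<close>
  have c: "card {a \<in> {n..<n + m}. a < n + i} = i" if "i < m" for i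
  proof -
    have "{a \<in> {n..<n + m}. a < n + i} = {n..<n + i}" using that by auto
    thus ?thesis by simp
  qed
  show ?thesis
  proof (rule eq_matI)
    fix i j assume "i < dim_row (mat m m (\<lambda>(i, j). A $$ (n + i, n + j)))"
      "j < dim_col (mat m m (\<lambda>(i, j). A $$ (n + i, n + j)))"
    hence ij: "i < m" "j < m" by auto
    show "submatrix A {n..<n + m} {n..<n + m} $$ (i, j) =
        mat m m (\<lambda>(i, j). A $$ (n + i, n + j)) $$ (i, j)"
      using submatrix_index_card[of "n + i" A "n + j" "{n..<n + m}" "{n..<n + m}"] ij assms
      unfolding c[OF ij(1)] c[OF ij(2)] by simp
  qed (use assms in \<open>simp_all add: dim_submatrix eq del: atLeastLessThan_iff\<close>)
qed

section \<open>Matrices diagonalised by the Fourier matrix\<close>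

definition unity_root :: "nat \<Rightarrow> nat \<Rightarrow> complex" where
  "unity_root N k = cis (2 * pi * real k / real N)"

definition fourier_mat :: "nat \<Rightarrow> complex mat" where
  "fourier_mat N = mat N N (\<lambda>(i, k). unity_root N k ^ i)"

text \<open>The conjugate transpose of \<open>fourier_mat N\<close> divided by N; conjugates appear
  as inverses because the roots have modulus 1.\<close>

definition fourier_inv_mat :: "nat \<Rightarrow> complex mat" where
  "fourier_inv_mat N = mat N N (\<lambda>(k, j). inverse (unity_root N k) ^ j / of_nat N)"

text \<open>The spectrum is a function of the root itself rather than of its index k, so that a
  Laurent polynomial can be inserted directly and matrix operations become pointwise operations on
  functions.\<close>

definition spectral_mat :: "nat \<Rightarrow> (complex \<Rightarrow> complex) \<Rightarrow> complex mat" where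
  "spectral_mat N f =
     fourier_mat N * mat_diag N (\<lambda>k. f (unity_root N k)) * fourier_inv_mat N"

lemma unity_root_nz [simp]: "unity_root N k \<noteq> 0"
  by (simp add: unity_root_def)

lemma bij_betw_unity_root: "N > 0 \<Longrightarrow> bij_betw (unity_root N) {..<N} {\<omega>. \<omega> ^ N = 1}"
  using bij_betw_roots_unity[of N] unfolding unity_root_def .

lemma unity_root_power: "k < N \<Longrightarrow> unity_root N k ^ N = 1"
  using bij_betwE[OF bij_betw_unity_root, of N] by auto

lemma fourier_mat_carrier [simp]:
  "fourier_mat N \<in> carrier_mat N N" "fourier_inv_mat N \<in> carrier_mat N N"
  by (simp_all add: fourier_mat_def fourier_inv_mat_def)

lemma spectral_mat_carrier [simp]: "spectral_mat N f \<in> carrier_mat N N"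
  unfolding spectral_mat_def by (intro mult_carrier_mat[of _ _ N]) auto

lemma spectral_mat_cong:
  assumes "\<And>\<omega>. \<omega> ^ N = 1 \<Longrightarrow> f \<omega> = g \<omega>"
  shows "spectral_mat N f = spectral_mat N g"
proof -
  have "mat_diag N (\<lambda>k. f (unity_root N k)) = mat_diag N (\<lambda>k. g (unity_root N k))"
    unfolding mat_diag_def using assms unity_root_power by (intro eq_matI) auto
  thus ?thesis by (simp add: spectral_mat_def)
qed

text \<open>Orthogonality of characters: entry (k, l) is a geometric sum in the quotient
  \<open>x\<close> of two roots, which is 1 for k = l and otherwise another N-th root of unity,
  making the sum vanish.\<close>

lemma fourier_inv_mult: "fourier_inv_mat N * fourier_mat N = 1\<^sub>m N"
proof (rule eq_matI)
  fix k l assume "k < dim_row (1\<^sub>m N :: complex mat)" "l < dim_col (1\<^sub>m N :: complex mat)"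
  hence kl: "k < N" "l < N" by auto
  define x where "x = unity_root N l / unity_root N k"
  have "(fourier_inv_mat N * fourier_mat N) $$ (k, l) =
      (\<Sum>j<N. inverse (unity_root N k) ^ j / of_nat N * unity_root N l ^ j)"
    using kl by (simp add: fourier_inv_mat_def fourier_mat_def scalar_prod_def atLeast0LessThan)
  also have "\<dots> = (\<Sum>j<N. x ^ j) / of_nat N"
    unfolding sum_divide_distrib x_def
    by (intro sum.cong) (auto simp: power_divide field_simps)
  also have "\<dots> = 1\<^sub>m N $$ (k, l)"
  proof (cases "k = l")
    case True
    thus ?thesis using kl by (simp add: x_def)
  next
    case False
    hence "unity_root N k \<noteq> unity_root N l"
      using bij_betw_imp_inj_on[OF bij_betw_unity_root, of N] kl by (auto dest: inj_onD)
    hence "x \<noteq> 1" by (simp add: x_def)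
    moreover have "x ^ N = 1" using kl by (simp add: x_def power_divide unity_root_power)
    ultimately show ?thesis using kl False by (simp add: geometric_sum)
  qed
  finally show "(fourier_inv_mat N * fourier_mat N) $$ (k, l) = 1\<^sub>m N $$ (k, l)" .
qed (simp_all add: fourier_inv_mat_def fourier_mat_def)

lemma fourier_mult_inv: "fourier_mat N * fourier_inv_mat N = 1\<^sub>m N"
  by (rule mat_mult_left_right_inverse[OF _ _ fourier_inv_mult]) auto

lemma spectral_mat_index:
  assumes ij: "i < N" "j < N"
  shows "spectral_mat N f $$ (i, j) =
    (\<Sum>\<omega> | \<omega> ^ N = 1. f \<omega> * \<omega> powi (int i - int j)) / of_nat N"
proof -
  have "spectral_mat N f $$ (i, j) = (\<Sum>k<N. unity_root N k ^ i * f (unity_root N k) *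
      (inverse (unity_root N k) ^ j / of_nat N))"
    unfolding spectral_mat_def mat_diag_mult_right[OF fourier_mat_carrier(1)] using ij
    by (simp add: fourier_inv_mat_def fourier_mat_def scalar_prod_def atLeast0LessThan)
  also have "\<dots> = (\<Sum>k<N. f (unity_root N k) * unity_root N k powi (int i - int j)) / of_nat N"
    unfolding sum_divide_distrib
    by (intro sum.cong) (auto simp: power_int_diff field_simps)
  also have "(\<Sum>k<N. f (unity_root N k) * unity_root N k powi (int i - int j)) =
      (\<Sum>\<omega> | \<omega> ^ N = 1. f \<omega> * \<omega> powi (int i - int j))"
    using ij by (intro sum.reindex_bij_betw bij_betw_unity_root) auto
  finally show ?thesis .
qed

lemma spectral_mat_one: "spectral_mat N (\<lambda>_. 1) = 1\<^sub>m N"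
  by (simp add: spectral_mat_def fourier_mult_inv right_mult_one_mat[of _ N N])

lemma spectral_mat_mult:
  "spectral_mat N f * spectral_mat N g = spectral_mat N (\<lambda>\<omega>. f \<omega> * g \<omega>)"
proof -
  let ?F = "fourier_mat N" and ?G = "fourier_inv_mat N"
  let ?D = "mat_diag N (\<lambda>k. f (unity_root N k))" and ?E = "mat_diag N (\<lambda>k. g (unity_root N k))"
  have [simp]: "?F * ?D \<in> carrier_mat N N" "?E * ?G \<in> carrier_mat N N"
      "?F * ?E \<in> carrier_mat N N" "?F * (?E * ?G) \<in> carrier_mat N N"
      "?D * ?E \<in> carrier_mat N N"
    by (auto intro!: mult_carrier_mat[of _ _ N])
  have "?F * ?D * ?G * (?F * ?E * ?G) = ?F * ?D * (?G * (?F * (?E * ?G)))"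
    by (simp add: assoc_mult_mat[of "?F * ?D" N N ?G N _ N] assoc_mult_mat[of ?F N N ?E N ?G N])
  also have "?G * (?F * (?E * ?G)) = (?G * ?F) * (?E * ?G)"
    by (rule assoc_mult_mat[symmetric, of _ N N _ N _ N]) auto
  also have "\<dots> = ?E * ?G" by (simp add: fourier_inv_mult left_mult_one_mat[of _ N N])
  also have "?F * ?D * (?E * ?G) = ?F * (?D * ?E) * ?G"
    by (simp add: assoc_mult_mat[of ?F N N ?D N "?E * ?G" N] assoc_mult_mat[of ?F N N "?D * ?E" N ?G N]
        assoc_mult_mat[of ?D N N ?E N ?G N] del: mat_diag_diag)
  finally show ?thesis by (simp add: spectral_mat_def)
qed

lemma det_mat_diag: "det (mat_diag n f) = (\<Prod>i<n. f i)" for f :: "nat \<Rightarrow> 'a :: comm_ring_1"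
proof -
  have "det (mat_diag n f) = prod_list (diag_mat (mat_diag n f))"
    by (rule det_upper_triangular[of _ n]) (auto simp: mat_diag_def upper_triangular_def)
  also have "diag_mat (mat_diag n f) = map f [0..<n]"
    by (auto simp: diag_mat_def mat_diag_def)
  also have "prod_list (map f [0..<n]) = (\<Prod>i<n. f i)"
    using prod.distinct_set_conv_list[of "[0..<n]" f] by (simp add: atLeast0LessThan)
  finally show ?thesis .
qed

lemma det_spectral_mat:
  assumes "N > 0"
  shows "det (spectral_mat N f) = (\<Prod>\<omega> | \<omega> ^ N = 1. f \<omega>)"
proof -
  let ?F = "fourier_mat N" and ?G = "fourier_inv_mat N"
  let ?D = "mat_diag N (\<lambda>k. f (unity_root N k))"
  have FD: "?F * ?D \<in> carrier_mat N N" by (auto intro!: mult_carrier_mat[of _ _ N])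
  have "det ?F * det ?G = 1"
    using det_mult[of ?F N ?G] by (simp add: fourier_mult_inv)
  hence "det (spectral_mat N f) = det ?D"
    using det_mult[OF FD, of ?G] det_mult[of ?F N ?D] by (simp add: spectral_mat_def mult_ac)
  also have "\<dots> = (\<Prod>k<N. f (unity_root N k))" by (rule det_mat_diag)
  also have "\<dots> = (\<Prod>\<omega> | \<omega> ^ N = 1. f \<omega>)"
    using assms by (intro prod.reindex_bij_betw bij_betw_unity_root)
  finally show ?thesis .
qed

lemma spectral_mat_smult: "c \<cdot>\<^sub>m spectral_mat N f = spectral_mat N (\<lambda>\<omega>. c * f \<omega>)"
  by (rule eq_matI)
    (auto simp: spectral_mat_index sum_distrib_left mult_ac carrier_matD[OF spectral_mat_carrier])

lemma spectral_mat_add: "spectral_mat N f + spectral_mat N g = spectral_mat N (\<lambda>\<omega>. f \<omega> + g \<omega>)"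
  by (rule eq_matI)
    (auto simp: spectral_mat_index sum.distrib algebra_simps add_divide_distrib
      carrier_matD[OF spectral_mat_carrier])

lemma spectral_mat_zero: "spectral_mat N (\<lambda>_. 0) = 0\<^sub>m N N"
  by (rule eq_matI) (auto simp: spectral_mat_index carrier_matD[OF spectral_mat_carrier])

text \<open>Entries involve i and j only through \<omega> to the power i - j, and this power depends
  only on the exponent modulo N because \<omega> is an N-th root of unity.\<close>

lemma circulant_spectral_mat: "circulant_mat N (spectral_mat N f)"
  unfolding circulant_mat_def
proof (intro conjI exI allI impI)
  fix i j assume ij: "i < N" "j < N"
  have "\<omega> powi (int i - int j) = \<omega> powi (- ((int j - int i) mod int N))"
    if "\<omega> ^ N = 1" for \<omega> :: complex
  proof -
    have nz: "\<omega> \<noteq> 0" using that ij by (auto simp: power_0_left)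
    define q where "q = (int j - int i) div int N"
    have "int i - int j = - ((int j - int i) mod int N) - int N * q"
      using mult_div_mod_eq[of "int N" "int j - int i"] unfolding q_def by linarith
    thus ?thesis using nz that by (simp add: power_int_diff power_int_mult)
  qed
  thus "spectral_mat N f $$ (i, j) = (\<lambda>r. (\<Sum>\<omega> | \<omega> ^ N = 1. f \<omega> * \<omega> powi (- r)) / of_nat N)
      ((int j - int i) mod int N)"
    using ij by (simp add: spectral_mat_index)
qed simp

text \<open>The sum is N times an entry of the identity matrix, whose spectrum is constantly
  1.\<close>

lemma sum_unity_roots_powi:
  assumes "\<bar>r\<bar> < int N"
  shows "(\<Sum>\<omega> | \<omega> ^ N = 1. \<omega> powi r :: complex) = (if r = 0 then of_nat N else 0)"
proof -
  \<comment> \<open>Writing r as the difference of its positive and negative parts turns it into a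
    difference of two valid indices; this is where the bound on r enters.\<close>
  have ij: "nat r < N" "nat (- r) < N" and r: "int (nat r) - int (nat (- r)) = r"
    using assms by auto
  have "(\<Sum>\<omega> | \<omega> ^ N = 1. \<omega> powi r :: complex) / of_nat N =
      (1\<^sub>m N :: complex mat) $$ (nat r, nat (- r))"
    using spectral_mat_index[OF ij, of "\<lambda>_. 1"] unfolding spectral_mat_one r by simp
  moreover have "of_nat N \<noteq> (0 :: complex)" using ij by simp
  ultimately show ?thesis using ij by (auto simp: field_simps split: if_splits)
qed

section \<open>Laurent polynomials in the cyclic shift\<close>

text \<open>Column k of the Fourier matrix lists the powers of the k-th root, so shifting it
  cyclically multiplies it by that root: it is an eigenvector.\<close>

lemma cyclic_shift_spectral: "cyclic_shift N = spectral_mat N (\<lambda>\<omega>. \<omega>)"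
proof -
  let ?F = "fourier_mat N" and ?G = "fourier_inv_mat N"
  have P: "cyclic_shift N \<in> carrier_mat N N" by (simp add: cyclic_shift_def)
  have PF: "cyclic_shift N * ?F = ?F * mat_diag N (unity_root N)"
    unfolding mat_diag_mult_right[OF fourier_mat_carrier(1)]
  proof (rule eq_matI)
    fix i k
    assume "i < dim_row (mat N N (\<lambda>(i, j). ?F $$ (i, j) * unity_root N j))"
      "k < dim_col (mat N N (\<lambda>(i, j). ?F $$ (i, j) * unity_root N j))"
    hence ik: "i < N" "k < N" by auto
    have "(cyclic_shift N * ?F) $$ (i, k) =
        (\<Sum>j<N. (if j mod N = Suc i mod N then 1 else 0) * unity_root N k ^ j)"
      using ik by (simp add: cyclic_shift_def fourier_mat_def scalar_prod_def atLeast0LessThan)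
    also have "\<dots> = (\<Sum>j<N. if j = Suc i mod N then unity_root N k ^ j else 0)"
      by (intro sum.cong) auto
    also have "\<dots> = unity_root N k ^ (Suc i mod N)"
      using ik by simp
    also have "\<dots> = unity_root N k ^ Suc i"
    \<comment> \<open>In the last row the shift wraps around to exponent 0, which agrees with
      exponent N since the N-th power of the root is 1.\<close>
    proof (cases "Suc i = N")
      case True
      thus ?thesis using unity_root_power[OF ik(2)] by simp
    next
      case False
      thus ?thesis using ik by simp
    qed
    finally show "(cyclic_shift N * ?F) $$ (i, k) =
        mat N N (\<lambda>(i, j). ?F $$ (i, j) * unity_root N j) $$ (i, k)"
      using ik by (simp add: fourier_mat_def)
  qed (simp_all add: cyclic_shift_def fourier_mat_def)
  have "cyclic_shift N = cyclic_shift N * (?F * ?G)"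
    using P by (simp add: fourier_mult_inv)
  also have "\<dots> = cyclic_shift N * ?F * ?G"
    by (rule assoc_mult_mat[OF P fourier_mat_carrier, symmetric])
  finally show ?thesis by (simp add: PF spectral_mat_def)
qed

text \<open>Serves twice: for the negative powers of the cyclic shift and for the inverse of the
  circulant matrix itself.\<close>

lemma inv_spectral_mat:
  assumes "\<And>\<omega>. \<omega> ^ N = 1 \<Longrightarrow> f \<omega> \<noteq> 0"
  shows "inv\<^bsub>cmat_ring N\<^esub> (spectral_mat N f) = spectral_mat N (\<lambda>\<omega>. inverse (f \<omega>))"
proof -
  interpret R: ring "cmat_ring N" by (rule ring_mat)
  have "spectral_mat N (\<lambda>\<omega>. f \<omega> * inverse (f \<omega>)) = 1\<^sub>m N"
    unfolding spectral_mat_one[symmetric] using assms by (intro spectral_mat_cong) simp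
  thus ?thesis
    by (intro R.inv_char) (simp_all add: ring_mat_simps spectral_mat_mult mult.commute)
qed

lemma spectral_mat_int_pow:
  assumes "\<And>\<omega>. \<omega> ^ N = 1 \<Longrightarrow> f \<omega> \<noteq> 0"
  shows "spectral_mat N f [^]\<^bsub>cmat_ring N\<^esub> (s :: int) = spectral_mat N (\<lambda>\<omega>. f \<omega> powi s)"
proof -
  interpret R: ring "cmat_ring N" by (rule ring_mat)
  have nat_pow: "spectral_mat N f [^]\<^bsub>cmat_ring N\<^esub> k = spectral_mat N (\<lambda>\<omega>. f \<omega> ^ k)" for k :: nat
    by (induction k) (simp_all add: ring_mat_simps spectral_mat_one spectral_mat_mult mult.commute)
  show ?thesis
    unfolding int_pow_def2 nat_pow using assms
    by (auto simp: inv_spectral_mat power_int_def power_inverse)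
qed

lemma spectral_mat_sum:
  assumes "finite I"
  shows "(\<Oplus>\<^bsub>cmat_ring N\<^esub>s\<in>I. spectral_mat N (f s)) = spectral_mat N (\<lambda>\<omega>. \<Sum>s\<in>I. f s \<omega>)"
proof -
  interpret R: ring "cmat_ring N" by (rule ring_mat)
  show ?thesis using assms
  proof (induction I rule: finite_induct)
    case empty
    show ?case by (simp add: ring_mat_simps spectral_mat_zero)
  next
    case (insert s I)
    have "(\<lambda>s. spectral_mat N (f s)) \<in> I \<rightarrow> carrier (cmat_ring N)"
      "spectral_mat N (f s) \<in> carrier (cmat_ring N)"
      by (simp_all add: ring_mat_simps)
    with insert show ?case
      by (simp add: R.finsum_insert) (simp add: ring_mat_simps spectral_mat_add)
  qed
qed

lemma laurent_mat_cyclic_shift: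
  assumes "N > 0"
  shows "laurent_mat N m a (cyclic_shift N) = spectral_mat N (laurent_eval m a)"
proof -
  have nz: "\<omega> \<noteq> 0" if "\<omega> ^ N = 1" for \<omega> :: complex
    using that assms by (auto simp: power_0_left)
  have pow: "cyclic_shift N [^]\<^bsub>cmat_ring N\<^esub> s = spectral_mat N (\<lambda>\<omega>. \<omega> powi s)" for s :: int
    unfolding cyclic_shift_spectral by (rule spectral_mat_int_pow[OF nz])
  show ?thesis
    unfolding laurent_mat_def pow spectral_mat_smult
    by (subst spectral_mat_sum) (simp_all add: laurent_eval_def[abs_def])
qed

text \<open>The entry averages \<omega> to the power s - (j - i) over the roots. In the leading
  block this exponent has absolute value at most m + n - 1 < N, so only s = j - i survives and no
  coefficient wraps around.\<close>

lemma laurent_eval_spectral_leading_block: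
  assumes supp: "\<And>s. \<bar>s\<bar> > int m \<Longrightarrow> a s = 0" and ij: "i < n" "j < n"
  shows "spectral_mat (n + m) (laurent_eval m a) $$ (i, j) = a (int j - int i)"
proof -
  let ?N = "n + m" and ?I = "{- int m..int m}" and ?d = "int i - int j"
  have "(\<Sum>\<omega> | \<omega> ^ ?N = 1. laurent_eval m a \<omega> * \<omega> powi ?d) =
      (\<Sum>\<omega> | \<omega> ^ ?N = 1. \<Sum>s\<in>?I. a s * \<omega> powi (s + ?d))"
  proof (intro sum.cong refl)
    fix \<omega> :: complex assume "\<omega> \<in> {\<omega>. \<omega> ^ ?N = 1}"
    hence "\<omega> \<noteq> 0" using ij by (auto simp: power_0_left)
    thus "laurent_eval m a \<omega> * \<omega> powi ?d = (\<Sum>s\<in>?I. a s * \<omega> powi (s + ?d))"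
      by (simp add: laurent_eval_def sum_distrib_right power_int_add mult.assoc)
  qed
  also have "\<dots> = (\<Sum>s\<in>?I. a s * (\<Sum>\<omega> | \<omega> ^ ?N = 1. \<omega> powi (s + ?d)))"
    by (subst sum.swap) (simp add: sum_distrib_left)
  also have "\<dots> = (\<Sum>s\<in>?I. if s = - ?d then a s * of_nat ?N else 0)"
    using ij by (intro sum.cong refl, subst sum_unity_roots_powi) auto
  \<comment> \<open>If j - i lies outside the range of summation, the sum is empty of nonzero terms
    and the coefficient vanishes by the support condition.\<close>
  also have "\<dots> = a (- ?d) * of_nat ?N"
    using supp[of "- ?d"] by (auto simp: sum.delta')
  finally have "(\<Sum>\<omega> | \<omega> ^ ?N = 1. laurent_eval m a \<omega> * \<omega> powi ?d) = a (- ?d) * of_nat ?N" .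
  moreover have "of_nat ?N \<noteq> (0 :: complex)" using ij by (simp del: of_nat_add)
  ultimately show ?thesis using ij by (simp add: spectral_mat_index del: of_nat_add)
qed

theorem proposition6p1:
  fixes m n N :: nat and a :: "int \<Rightarrow> complex" and C Cinv :: "complex mat" and S :: "nat set"
    and D :: complex
  assumes "m \<ge> 1"
    and "\<And>s. \<bar>s\<bar> > int m \<Longrightarrow> a s = 0"
    and "n > m"
    and "N = n + m"
    and "D = det (toeplitz_mat n a)"
    and "C = laurent_mat N m a (cyclic_shift N)"
    and "invertible_mat C"
    and "Cinv = inv\<^bsub>cmat_ring N\<^esub> C"
    and "S = {n..<N}"
  shows "D = det C * det (submatrix Cinv S S)
    \<and> submatrix Cinv S S \<in> carrier_mat m m
    \<and> circulant_mat N Cinv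
    \<and> D = (\<Prod>\<omega> | \<omega> ^ N = 1. laurent_eval m a \<omega>)
          * det (toeplitz_mat m (inv_symbol_coeff N m a))"
proof -
  let ?f = "laurent_eval m a"
  have N: "N > 0" using assms by simp
  have C: "C = spectral_mat N ?f"
    using assms laurent_mat_cyclic_shift[OF N] by simp
  have Cc: "C \<in> carrier_mat N N" by (simp add: C)
  have detC: "det C = (\<Prod>\<omega> | \<omega> ^ N = 1. ?f \<omega>)"
    unfolding C by (rule det_spectral_mat[OF N])
  obtain B where B: "C * B = 1\<^sub>m N" "B * C = 1\<^sub>m (dim_row B)"
    using assms(7) Cc unfolding invertible_mat_def inverts_mat_def by auto
  \<comment> \<open>The size of \<open>B\<close> is not part of \<open>invertible_mat\<close>; it
    follows by comparing column counts in the two inverse equations.\<close>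
  have "B \<in> carrier_mat N N"
    using arg_cong[OF B(1), of dim_col] arg_cong[OF B(2), of dim_col] Cc by auto
  hence "det C \<noteq> 0" using det_mult[OF Cc, of B] B by auto
  moreover have "finite {\<omega> :: complex. \<omega> ^ N = 1}"
    using bij_betw_finite[OF bij_betw_unity_root[OF N]] by simp
  \<comment> \<open>The determinant is the product of the symbol over the roots, so nonsingularity
    forces each factor to be nonzero.\<close>
  ultimately have nz: "?f \<omega> \<noteq> 0" if "\<omega> ^ N = 1" for \<omega>
    using that unfolding detC by (auto simp: prod_zero_iff)
  have Ci: "Cinv = spectral_mat N (\<lambda>\<omega>. inverse (?f \<omega>))"
    unfolding assms(8) C by (rule inv_spectral_mat[OF nz])
  have Cic: "Cinv \<in> carrier_mat N N" by (simp add: Ci)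
  have "spectral_mat N (\<lambda>\<omega>. ?f \<omega> * inverse (?f \<omega>)) = 1\<^sub>m N"
    unfolding spectral_mat_one[symmetric] using nz by (intro spectral_mat_cong) simp
  hence CCi: "C * Cinv = 1\<^sub>m N" by (simp add: C Ci spectral_mat_mult)
  have sub: "submatrix Cinv S S = mat m m (\<lambda>(i, j). Cinv $$ (n + i, n + j))"
    using Cic submatrix_atLeastLessThan assms(4,9) by simp
  have "mat n n (\<lambda>(i, j). C $$ (i, j)) = toeplitz_mat n a"
    unfolding toeplitz_mat_def C assms(4)
    using laurent_eval_spectral_leading_block[OF assms(2)] by (intro cong_mat) auto
  hence D: "D = det C * det (submatrix Cinv S S)"
    using det_leading_block[of C n m Cinv] Cc Cic CCi assms(4,5) sub by simp
  \<comment> \<open>The offset n cancels in differences of indices, so the trailing block has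
    entries depending on r = j - i; the exponent i - j in \<open>spectral_mat_index\<close> is the
    exponent - r of \<open>inv_symbol_coeff\<close>.\<close>
  moreover have "submatrix Cinv S S = toeplitz_mat m (inv_symbol_coeff N m a)"
    unfolding sub unfolding toeplitz_mat_def Ci inv_symbol_coeff_def using assms(4)
    by (intro cong_mat) (simp_all add: spectral_mat_index divide_inverse mult.commute)
  ultimately show ?thesis
    using circulant_spectral_mat[of N "\<lambda>\<omega>. inverse (?f \<omega>)"] detC sub Ci by simp
qed

end
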